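(* Let $k\ge 2$. For any harmonious $k$-tuple $(M_1,\ldots,M_k)$ we have \[ M_1\cdots M_k\le k^{-k}\left(2^{2^{L}}-2^{2^{L-1}}\right), \] where $L=\Omega(M_1\cdots M_k)$. For any unitary harmonious $k$-tuple $(M_1,\ldots,M_k)$ the same upper bound holds with $L=\omega(M_1)+\cdots+\omega(M_k)$.
   Context: $\sigma(n)$ is the sum of the positive divisors of $n$; $\sigma^\ast(n)=\sum_{d\parallel n} d$, where $d\parallel n$ means $d\mid n$ and $\gcd(d,n/d)=1$. $\Omega(n)$ is the number of prime factors of $n$ counted with multiplicity and $\omega(n)$ the number of distinct prime factors. For $k\ge2$, a tuple of positive integers $(M_i)_{i=1}^k$ is harmonious if $\sum_{i=1}^k M_i/\sigma(M_i)=1$, and unitary harmonious if $\sum_{i=1}^k M_i/\sigma^\ast(M_i)=1$. *)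

theory Defs
  imports Complex_Main "HOL-Computational_Algebra.Primes"
begin

definition sigma :: "nat \<Rightarrow> nat" where
  "sigma n = (\<Sum>d | d dvd n. d)"

definition unitary_sigma :: "nat \<Rightarrow> nat" where
  "unitary_sigma n = (\<Sum>d | d dvd n \<and> gcd d (n div d) = 1. d)"

definition big_omega :: "nat \<Rightarrow> nat" where
  "big_omega n = size (prime_factorization n)"

definition small_omega :: "nat \<Rightarrow> nat" where
  "small_omega n = card (prime_factors n)"

text \<open>A \<open>k\<close>-tuple is a function whose values outside \<open>{1..k}\<close> are irrelevant.\<close>

definition harmonious :: "nat \<Rightarrow> (nat \<Rightarrow> nat) \<Rightarrow> bool" where
  "harmonious k M \<longleftrightarrow> k \<ge> 2 \<and> (\<forall>i\<in>{1..k}. M i > 0) \<and>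
     (\<Sum>i=1..k. real (M i) / real (sigma (M i))) = 1"

definition unitary_harmonious :: "nat \<Rightarrow> (nat \<Rightarrow> nat) \<Rightarrow> bool" where
  "unitary_harmonious k M \<longleftrightarrow> k \<ge> 2 \<and> (\<forall>i\<in>{1..k}. M i > 0) \<and>
     (\<Sum>i=1..k. real (M i) / real (unitary_sigma (M i))) = 1"

text \<open>Only \<open>L \<ge> 1\<close> matters: a (unitary) harmonious tuple cannot consist of ones only,
  so the truncated \<open>L - 1\<close> is a genuine subtraction.\<close>

definition harmonious_bound :: "nat \<Rightarrow> nat \<Rightarrow> real" where
  "harmonious_bound k L = real k powi (- int k) * (2 ^ (2 ^ L) - 2 ^ (2 ^ (L - 1)))"

end

theory Submission
  imports Defs
begin

text \<open>Since \<open>\<sigma>(p\<^sup>j) = p \<sigma>(p\<^sup>j\<^sup>-\<^sup>1) + 1\<close>, the ratio \<open>n / \<sigma>(n)\<close> is a product of \<open>\<Omega>(n)\<close> factors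
  \<open>1 - 1 / x\<close> with \<open>x = \<sigma>(p\<^sup>j)\<close>, and similarly \<open>n / \<sigma>\<^sup>*(n)\<close> is a product of \<open>\<omega>(n)\<close> such
  factors. Sort all the \<open>L\<close> numbers \<open>x\<close> occurring in the tuple. Dropping all but the first \<open>m\<close> factors
  makes the sum exceed \<open>1\<close> by at least \<open>1 / (x\<^sub>1 \<cdots> x\<^sub>m)\<close>, so the dropped ones have product at most
  \<open>1 / (1 + 1 / (x\<^sub>1 \<cdots> x\<^sub>m))\<close>. Among sorted sequences with this property, the product of all
  terms is largest when equality holds throughout, that is, for the sequence \<open>2 + 1, 2\<^sup>2 + 1,
  2\<^sup>4 + 1, \<dots>\<close> with the \<open>1\<close> omitted from its last term.\<close>

section \<open>A convexity inequality for logarithms\<close>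

text \<open>Convexity of \<open>t \<mapsto> - ln (1 - exp (- t))\<close>: its graph lies above the
  tangent at \<open>t = ln x\<close>, whose slope is \<open>- 1 / (x - 1)\<close>.\<close>

lemma ln_ratio_minus_one_le:
  fixes x y :: real
  assumes "x > 1" "y > 1"
  shows "ln (x / (x - 1)) - ln (y / (y - 1)) \<le> (ln y - ln x) / (x - 1)"
proof -
  have "ln ((y - 1) * x / ((x - 1) * y)) \<le> (y - 1) * x / ((x - 1) * y) - 1"
    using assms by (intro ln_le_minus_one) auto
  then have "(x - 1) * ln ((y - 1) * x / ((x - 1) * y)) \<le> (x - 1) * ((y - 1) * x / ((x - 1) * y) - 1)"
    using assms by (intro mult_left_mono) auto
  moreover have "ln (x / y) \<le> x / y - 1"
    using assms by (intro ln_le_minus_one) auto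
  \<comment> \<open>The two instances of \<open>ln u \<le> u - 1\<close> are weighted by
    \<open>x - 1\<close> and \<open>1\<close> precisely so that their right-hand sides
    cancel.\<close>
  moreover have "(x - 1) * ((y - 1) * x / ((x - 1) * y) - 1) + (x / y - 1) = 0"
    using assms by (simp add: divide_simps) (simp add: algebra_simps)
  ultimately have "(x - 1) * ln ((y - 1) * x / ((x - 1) * y)) + ln (x / y) \<le> 0"
    by linarith
  then have "(x - 1) * (ln (y - 1) + ln x - ln (x - 1) - ln y) + (ln x - ln y) \<le> 0"
    using assms by (simp add: ln_div ln_mult diff_diff_eq)
  then have "(x - 1) * (ln x - ln (x - 1) - (ln y - ln (y - 1))) \<le> ln y - ln x"
    by (simp add: algebra_simps)
  then show ?thesis
    using assms by (simp add: ln_div pos_le_divide_eq mult.commute)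
qed

text \<open>Abel summation done by induction: when \<open>n\<close> grows by one, the weight on the
  nonnegative partial sum drops from \<open>w (n - 1)\<close> to \<open>w n\<close>, which only
  lowers the left side.\<close>

lemma decseq_weighted_sum_ge:
  fixes w d :: "nat \<Rightarrow> real"
  assumes "m < n"
    and "\<And>j. m \<le> j \<Longrightarrow> Suc j < n \<Longrightarrow> w (Suc j) \<le> w j"
    and "\<And>j. m < j \<Longrightarrow> j < n \<Longrightarrow> 0 \<le> sum d {m..<j}"
  shows "w (n - 1) * sum d {m..<n} \<le> (\<Sum>j=m..<n. w j * d j)"
  using assms
proof (induction n)
  case 0
  then show ?case by simp
next
  case (Suc n)
  show ?case
  proof (cases "m = n")
    case True
    then show ?thesis by simp
  next
    case False
    then have mn: "m < n" using Suc.prems(1) by simp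
    have "w n \<le> w (n - 1)" using Suc.prems(2)[of "n - 1"] mn by simp
    moreover have "0 \<le> sum d {m..<n}" using Suc.prems(3)[of n] mn by simp
    ultimately have "w n * sum d {m..<n} \<le> w (n - 1) * sum d {m..<n}"
      by (rule mult_right_mono)
    also have "\<dots> \<le> (\<Sum>j=m..<n. w j * d j)"
      using mn Suc.prems by (intro Suc.IH) auto
    finally show ?thesis using mn by (simp add: algebra_simps)
  qed
qed

text \<open>A majorization inequality for the function \<open>t \<mapsto> - ln (1 - exp (- t))\<close>, which is convex
  and decreasing; only the sequence with the larger partial products has to be sorted.\<close>

lemma sum_ln_ratio_less:
  fixes x y :: "nat \<Rightarrow> real"
  assumes "m < n"
    and x: "\<And>j. m \<le> j \<Longrightarrow> j < n \<Longrightarrow> x j > 1"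
    and y: "\<And>j. m \<le> j \<Longrightarrow> j < n \<Longrightarrow> y j > 1"
    and mono: "\<And>j. m \<le> j \<Longrightarrow> Suc j < n \<Longrightarrow> x j \<le> x (Suc j)"
    and less: "\<And>j. m < j \<Longrightarrow> j \<le> n \<Longrightarrow> prod y {m..<j} < prod x {m..<j}"
  shows "(\<Sum>j=m..<n. ln (x j / (x j - 1))) < (\<Sum>j=m..<n. ln (y j / (y j - 1)))"
proof -
  \<comment> \<open>Minus the slope of the tangent at \<open>ln (x j)\<close>. It decreases in
    \<open>j\<close> because \<open>x\<close> is sorted; \<open>less\<close> makes the partial sums
    of \<open>d\<close> positive.\<close>
  define w where "w = (\<lambda>j. 1 / (x j - 1))"
  define d where "d = (\<lambda>j. ln (x j) - ln (y j))"
  have D: "0 < sum d {m..<j}" if "m < j" "j \<le> n" for j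
  proof -
    have "ln (prod y {m..<j}) < ln (prod x {m..<j})"
    proof (subst ln_less_cancel_iff)
      show "0 < prod y {m..<j}"
        using that by (intro prod_pos ballI order_less_trans[OF zero_less_one y]) auto
      show "0 < prod x {m..<j}"
        using that by (intro prod_pos ballI order_less_trans[OF zero_less_one x]) auto
    qed (use less that in auto)
    moreover have "ln (prod y {m..<j}) = (\<Sum>i=m..<j. ln (y i))"
    proof (rule ln_prod)
      fix i assume "i \<in> {m..<j}"
      then show "y i \<noteq> 0" using y[of i] that by auto
    qed simp
    moreover have "ln (prod x {m..<j}) = (\<Sum>i=m..<j. ln (x i))"
    proof (rule ln_prod)
      fix i assume "i \<in> {m..<j}"
      then show "x i \<noteq> 0" using x[of i] that by auto
    qed simp
    ultimately show ?thesis by (simp add: d_def sum_subtractf)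
  qed
  \<comment> \<open>Strictness of the conclusion comes from here: \<open>less\<close> also covers
    the full range \<open>j = n\<close>.\<close>
  have "0 < w (n - 1) * sum d {m..<n}"
    using D[of n] x[of "n - 1"] \<open>m < n\<close> by (simp add: w_def)
  also have "\<dots> \<le> (\<Sum>j=m..<n. w j * d j)"
  proof (rule decseq_weighted_sum_ge[OF \<open>m < n\<close>])
    fix j assume "m \<le> j" "Suc j < n"
    then show "w (Suc j) \<le> w j"
      using mono[of j] x[of j] by (simp add: w_def frac_le)
  next
    fix j assume "m < j" "j < n"
    then show "0 \<le> sum d {m..<j}" using D[of j] by simp
  qed
  also have "\<dots> \<le> (\<Sum>j=m..<n. ln (y j / (y j - 1)) - ln (x j / (x j - 1)))"
  proof (rule sum_mono)
    fix j assume "j \<in> {m..<n}"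
    then have "ln (x j / (x j - 1)) - ln (y j / (y j - 1)) \<le> (ln (y j) - ln (x j)) / (x j - 1)"
      by (intro ln_ratio_minus_one_le x y) auto
    moreover have "(ln (y j) - ln (x j)) / (x j - 1) = - (w j * d j)"
      by (simp add: w_def d_def minus_divide_left)
    ultimately show "w j * d j \<le> ln (y j / (y j - 1)) - ln (x j / (x j - 1))"
      by linarith
  qed
  finally show ?thesis by (simp add: sum_subtractf)
qed

section \<open>The extremal sequence\<close>

text \<open>Fermat numbers, except that the last entry lacks its \<open>1\<close>. This change makes
  the tail bound an equality for every starting index, see
  \<open>sum_ln_extremal_seq\<close>.\<close>

definition extremal_seq :: "nat \<Rightarrow> nat \<Rightarrow> real" where
  "extremal_seq n j = (if Suc j < n then 2 ^ 2 ^ j + 1 else 2 ^ 2 ^ j)"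

lemma extremal_seq_gt_one: "extremal_seq n j > 1"
  by (simp add: extremal_seq_def add_pos_pos)

lemma power_two_power_Suc: "(b::real) ^ 2 ^ Suc m = b ^ 2 ^ m * b ^ 2 ^ m"
  by (simp add: power_add mult_2)

lemma prod_extremal_seq:
  assumes "m < n"
  shows "(\<Prod>j<m. extremal_seq n j) = 2 ^ 2 ^ m - 1"
  using assms
proof (induction m)
  case 0
  then show ?case by simp
next
  case (Suc m)
  then have "(\<Prod>j<Suc m. extremal_seq n j) = (2 ^ 2 ^ m - 1) * (2 ^ 2 ^ m + 1)"
    by (simp add: extremal_seq_def)
  then show ?case
    unfolding power_two_power_Suc by (simp add: algebra_simps)
qed

lemma prod_extremal_seq_full:
  assumes "n > 0"
  shows "(\<Prod>j<n. extremal_seq n j) = 2 ^ 2 ^ n - 2 ^ 2 ^ (n - 1)"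
proof -
  obtain m where n: "n = Suc m" using assms by (cases n) auto
  have "(\<Prod>j<m. extremal_seq n j) = 2 ^ 2 ^ m - 1" by (rule prod_extremal_seq) (simp add: n)
  then have "(\<Prod>j<n. extremal_seq n j) = (2 ^ 2 ^ m - 1) * 2 ^ 2 ^ m"
    by (simp add: n extremal_seq_def)
  then show ?thesis
    unfolding n power_two_power_Suc by (simp add: algebra_simps)
qed

text \<open>With \<open>t = 2 ^ 2 ^ m\<close> the tail telescopes from the end:
  \<open>(t + 1) / t\<close> times \<open>t\<^sup>2 / (t\<^sup>2 - 1)\<close> is
  \<open>t / (t - 1)\<close>, and the product of the first \<open>m\<close> entries is
  \<open>t - 1\<close>.\<close>

lemma sum_ln_extremal_seq:
  assumes "m < n"
  shows "(\<Sum>j=m..<n. ln (extremal_seq n j / (extremal_seq n j - 1))) =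
    ln (1 + 1 / (\<Prod>j<m. extremal_seq n j))"
proof -
  let ?g = "\<lambda>j. ln (extremal_seq n j / (extremal_seq n j - 1))"
  have "sum ?g {m..<n} = ln (2 ^ 2 ^ m / (2 ^ 2 ^ m - 1))"
    using assms
  proof (induction "n - Suc m" arbitrary: m)
    case 0
    then have "n = Suc m" by simp
    \<comment> \<open>The last entry is \<open>t\<close> rather than \<open>t + 1\<close>, so its
      factor is already \<open>t / (t - 1)\<close>.\<close>
    then show ?case by (simp add: extremal_seq_def)
  next
    case (Suc l)
    have gt: "(2::real) ^ 2 ^ m > 1" by simp
    have m: "Suc m < n" using Suc.hyps(2) by simp
    have "sum ?g {m..<n} = ?g m + sum ?g {Suc m..<n}"
      using Suc.prems by (rule sum.atLeast_Suc_lessThan)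
    also have "sum ?g {Suc m..<n} = ln (2 ^ 2 ^ Suc m / (2 ^ 2 ^ Suc m - 1))"
      using Suc.hyps(2) m by (intro Suc.hyps(1)) auto
    also have "?g m = ln ((2 ^ 2 ^ m + 1) / 2 ^ 2 ^ m)"
      using m by (simp add: extremal_seq_def)
    also have "ln ((2 ^ 2 ^ m + 1) / 2 ^ 2 ^ m) + ln (2 ^ 2 ^ Suc m / (2 ^ 2 ^ Suc m - 1)) =
        ln ((2 ^ 2 ^ m + 1) / 2 ^ 2 ^ m * (2 ^ 2 ^ Suc m / (2 ^ 2 ^ Suc m - 1 :: real)))"
    proof (rule ln_mult_pos[symmetric])
      have "0 < t / (t - 1)" if "t > 1" for t :: real
        using that by simp
      from this[OF one_less_power] show "(0::real) < 2 ^ 2 ^ Suc m / (2 ^ 2 ^ Suc m - 1)"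
        by auto
      show "(0::real) < (2 ^ 2 ^ m + 1) / 2 ^ 2 ^ m"
        by (intro divide_pos_pos add_pos_pos) auto
    qed
    also have "(2 ^ 2 ^ m + 1) / 2 ^ 2 ^ m * (2 ^ 2 ^ Suc m / (2 ^ 2 ^ Suc m - 1)) =
        (2::real) ^ 2 ^ m / (2 ^ 2 ^ m - 1)"
    proof -
      have "(t + 1) / t * (t * t / (t * t - 1)) = t / (t - 1)" if "t > 1" for t :: real
      proof -
        have "t * t - 1 = (t + 1) * (t - 1)" by (simp add: algebra_simps)
        then show ?thesis using that by simp
      qed
      from this[OF gt] show ?thesis unfolding power_two_power_Suc .
    qed
    finally show ?case .
  qed
  moreover have "t / (t - 1) = 1 + 1 / (t - 1)" if "t > 1" for t :: real
    using that by (simp add: field_simps)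
  then have "(2::real) ^ 2 ^ m / (2 ^ 2 ^ m - 1) = 1 + 1 / (2 ^ 2 ^ m - 1)"
    by simp
  ultimately show ?thesis using prod_extremal_seq[OF assms] by simp
qed

section \<open>From tail bounds to a bound on the product\<close>

text \<open>If the product were too large, there would be a last \<open>m\<close> up to which
  \<open>x\<close> has not overtaken the extremal sequence. After \<open>m\<close> the products of
  \<open>x\<close> are strictly larger, so its logarithmic tail is strictly smaller than the
  extremal one; yet the smaller initial product demands a tail at least as large.\<close>

lemma prod_le_of_tail_bounds:
  fixes x :: "nat \<Rightarrow> real"
  assumes "n > 0"
    and x: "\<And>j. j < n \<Longrightarrow> x j > 1"
    and mono: "\<And>j. Suc j < n \<Longrightarrow> x j \<le> x (Suc j)"
    and tail: "\<And>m. m < n \<Longrightarrow> ln (1 + 1 / (\<Prod>j<m. x j)) \<le> (\<Sum>j=m..<n. ln (x j / (x j - 1)))"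
  shows "(\<Prod>j<n. x j) \<le> 2 ^ 2 ^ n - 2 ^ 2 ^ (n - 1)"
proof (rule ccontr)
  let ?y = "extremal_seq n"
  assume "\<not> ?thesis"
  then have final: "prod ?y {..<n} < prod x {..<n}"
    using prod_extremal_seq_full[OF \<open>n > 0\<close>] by simp
  \<comment> \<open>The maximum exists because both empty products equal \<open>1\<close> at index
    \<open>0\<close>; \<open>final\<close> excludes \<open>m = n\<close>.\<close>
  define m where "m = Max {i. i \<le> n \<and> prod x {..<i} \<le> prod ?y {..<i}}"
  have fin: "finite {i. i \<le> n \<and> prod x {..<i} \<le> prod ?y {..<i}}" by simp
  have "0 \<in> {i. i \<le> n \<and> prod x {..<i} \<le> prod ?y {..<i}}" by simp
  then have "m \<in> {i. i \<le> n \<and> prod x {..<i} \<le> prod ?y {..<i}}"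
    unfolding m_def using fin by (intro Max_in) auto
  then have "m \<le> n" and m: "prod x {..<m} \<le> prod ?y {..<m}" by auto
  have "m < n" using \<open>m \<le> n\<close> m final by (cases "m = n") auto
  have xpos: "0 < prod x {..<m}"
    using \<open>m < n\<close> by (intro prod_pos ballI order_less_trans[OF zero_less_one x]) auto
  \<comment> \<open>Otherwise multiplying by the comparison at \<open>m\<close> would put
    \<open>j > m\<close> into the set whose maximum is \<open>m\<close>.\<close>
  have less: "prod ?y {m..<j} < prod x {m..<j}" if "m < j" "j \<le> n" for j
  proof (rule ccontr)
    assume "\<not> ?thesis"
    then have "prod x {m..<j} \<le> prod ?y {m..<j}" by simp
    then have "prod x {..<m} * prod x {m..<j} \<le> prod ?y {..<m} * prod ?y {m..<j}"
      using xpos m that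
      by (intro mult_mono prod_nonneg)
        (auto intro!: prod_nonneg less_imp_le[OF order_less_trans[OF zero_less_one x]]
          less_imp_le[OF order_less_trans[OF zero_less_one extremal_seq_gt_one]])
    then have "prod x {..<j} \<le> prod ?y {..<j}"
      using that by (simp add: lessThan_atLeast0 prod.atLeastLessThan_concat)
    then have "j \<le> m" unfolding m_def using fin that by (intro Max_ge) auto
    then show False using that by simp
  qed
  have "ln (1 + 1 / prod ?y {..<m}) \<le> ln (1 + 1 / prod x {..<m})"
    using xpos m by (intro ln_mono add_left_mono divide_left_mono) (auto intro: add_pos_pos)
  also have "\<dots> \<le> (\<Sum>j=m..<n. ln (x j / (x j - 1)))"
    using \<open>m < n\<close> by (rule tail)
  also have "\<dots> < (\<Sum>j=m..<n. ln (?y j / (?y j - 1)))"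
    using \<open>m < n\<close> x mono less by (intro sum_ln_ratio_less extremal_seq_gt_one) auto
  also have "\<dots> = ln (1 + 1 / prod ?y {..<m})"
    using \<open>m < n\<close> by (rule sum_ln_extremal_seq)
  finally show False by simp
qed

section \<open>Tail bounds from integrality\<close>

text \<open>Here \<open>c j\<close> names the summand that contains the factor of
  \<open>x j\<close>. The sum \<open>G m\<close> formed from the first \<open>m\<close> factors
  exceeds \<open>1\<close> and has denominator dividing the product of the first \<open>m\<close>
  entries, so it exceeds \<open>1\<close> by at least the reciprocal of that product. The remaining
  factors must bring it down to \<open>1\<close>.\<close>

lemma prod_le_of_sum_prod_sorted:
  fixes x :: "nat \<Rightarrow> nat" and c :: "nat \<Rightarrow> 'i"
  assumes "finite I" and "n > 0"
    and x: "\<And>j. j < n \<Longrightarrow> x j \<ge> 2"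
    and mono: "\<And>j. Suc j < n \<Longrightarrow> x j \<le> x (Suc j)"
    and c: "\<And>j. j < n \<Longrightarrow> c j \<in> I"
    and eq: "(\<Sum>i\<in>I. \<Prod>j<n. if c j = i then 1 - 1 / real (x j) else 1) = 1"
  shows "real (\<Prod>j<n. x j) \<le> 2 ^ 2 ^ n - 2 ^ 2 ^ (n - 1)"
proof -
  define T where "T = (\<lambda>m i. \<Prod>j<m. if c j = i then 1 - 1 / real (x j) else 1)"
  define G where "G = (\<lambda>m. \<Sum>i\<in>I. T m i)"
  have frac: "0 < 1 - 1 / real (x j)" "1 - 1 / real (x j) < 1" if "j < n" for j
    using x[OF that] by auto
  have Tpos: "0 < T m i" if "m \<le> n" for m i
    unfolding T_def using that frac by (intro prod_pos) auto
  have T_Suc: "T (Suc m) i = T m i * (if c m = i then 1 - 1 / real (x m) else 1)" for m i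
    by (simp add: T_def)
  \<comment> \<open>Each factor is below \<open>1\<close> and, as \<open>c m\<close> lies in
    \<open>I\<close>, really occurs in some summand.\<close>
  have G_less: "G (Suc m) < G m" if "m < n" for m
    unfolding G_def
  proof (rule sum_strict_mono_ex1[OF \<open>finite I\<close>])
    show "\<forall>i\<in>I. T (Suc m) i \<le> T m i"
      using Tpos[of m] frac[OF that] that
      by (auto simp: T_Suc intro!: mult_right_le_one_le less_imp_le)
    show "\<exists>i\<in>I. T (Suc m) i < T m i"
      using Tpos[of m "c m"] frac[OF that] that c[OF that]
      by (intro bexI[of _ "c m"]) (auto simp: T_Suc)
  qed
  have G_n: "G n = 1" using eq by (simp add: G_def T_def)
  have G_gt: "G m > 1" if "m < n" for m
    using that
  proof (induction "n - Suc m" arbitrary: m)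
    case 0
    then have "n = Suc m" by simp
    then show ?case using G_less[of m] G_n by simp
  next
    case (Suc l)
    then have "1 < G (Suc m)" by (intro Suc.hyps(1)) auto
    then show ?case using G_less[of m] Suc.prems by simp
  qed
  \<comment> \<open>A factor acts on one summand only; applying it to all of them can only make the
    sum smaller.\<close>
  have G_tail: "G m * (\<Prod>j=m..<l. 1 - 1 / real (x j)) \<le> G l" if "m \<le> l" "l \<le> n" for m l
    using that
  proof (induction l rule: dec_induct)
    case base
    then show ?case by simp
  next
    case (step l)
    then have l: "l < n" by simp
    have "G m * (\<Prod>j=m..<Suc l. 1 - 1 / real (x j)) \<le> G l * (1 - 1 / real (x l))"
      using step frac[OF l] by (simp add: mult.assoc[symmetric] mult_right_mono)
    also have "\<dots> \<le> G (Suc l)"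
      unfolding G_def sum_distrib_right
      using Tpos[of l] frac[OF l] l
      by (intro sum_mono) (auto simp: T_Suc intro!: mult_right_le_one_le less_imp_le)
    finally show ?case .
  qed
  have tail: "ln (1 + 1 / (\<Prod>j<m. real (x j))) \<le>
      (\<Sum>j=m..<n. ln (real (x j) / (real (x j) - 1)))" if "m < n" for m
  proof -
    let ?P = "\<Prod>j<m. real (x j)"
    have P: "?P > 0" using that order_less_le_trans[OF _ x] by (intro prod_pos) auto
    \<comment> \<open>Multiplying by \<open>?P\<close> turns each factor \<open>1 - 1 / x j\<close>
      into \<open>x j - 1\<close> and each trivial factor into \<open>x j\<close>, which leaves an
      integer.\<close>
    have "G m * ?P = of_int (\<Sum>i\<in>I. \<Prod>j<m. if c j = i then int (x j) - 1 else int (x j))"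
    proof -
      have "T m i * ?P = (\<Prod>j<m. if c j = i then real (x j) - 1 else real (x j))" for i
        unfolding T_def prod.distrib[symmetric]
      proof (intro prod.cong refl)
        fix j assume "j \<in> {..<m}"
        then have "x j \<ge> 2" using x that by auto
        then show "(if c j = i then 1 - 1 / real (x j) else 1) * real (x j) =
            (if c j = i then real (x j) - 1 else real (x j))"
          by (auto simp: field_simps)
      qed
      then show ?thesis
        by (simp add: G_def sum_distrib_right if_distrib cong: if_cong)
    qed
    then obtain g :: int where g: "G m * ?P = of_int g" by blast
    \<comment> \<open>Both sides are integers, so the strict inequality gains a full unit.\<close>
    have "of_int (int (\<Prod>j<m. x j)) < (of_int g :: real)"
      using G_gt[OF that] P by (simp add: g[symmetric])
    then have "int (\<Prod>j<m. x j) + 1 \<le> g" by linarith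
    then have "of_int (int (\<Prod>j<m. x j) + 1) \<le> (of_int g :: real)" by linarith
    then have "?P + 1 \<le> G m * ?P" by (simp add: g)
    then have "(?P + 1) / ?P \<le> G m" using P by (simp only: pos_divide_le_eq)
    moreover have "(t + 1) / t = 1 + 1 / t" if "t > 0" for t :: real
      using that by (simp add: field_simps)
    note this[OF P]
    ultimately have "1 + 1 / ?P \<le> G m" by (simp only:)
    moreover have tpos: "0 < (\<Prod>j=m..<n. 1 - 1 / real (x j))"
      using frac by (intro prod_pos) auto
    ultimately have "(1 + 1 / ?P) * (\<Prod>j=m..<n. 1 - 1 / real (x j)) \<le>
        G m * (\<Prod>j=m..<n. 1 - 1 / real (x j))"
      by (intro mult_right_mono) simp_all
    also have "\<dots> \<le> 1" using G_tail[of m n] G_n that by simp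
    finally have "(1 + 1 / ?P) * (\<Prod>j=m..<n. 1 - 1 / real (x j)) \<le> 1" .
    then have "1 + 1 / ?P \<le> inverse (\<Prod>j=m..<n. 1 - 1 / real (x j))"
      using tpos by (simp only: inverse_eq_divide pos_le_divide_eq)
    also have "\<dots> = (\<Prod>j=m..<n. real (x j) / (real (x j) - 1))"
      unfolding prod_inversef[symmetric] o_def
    proof (intro prod.cong refl)
      fix j assume "j \<in> {m..<n}"
      then have "x j \<ge> 2" using x by auto
      then show "inverse (1 - 1 / real (x j)) = real (x j) / (real (x j) - 1)"
        by (simp add: field_simps)
    qed
    finally have "ln (1 + 1 / ?P) \<le> ln (\<Prod>j=m..<n. real (x j) / (real (x j) - 1))"
      using P by (intro ln_mono) (auto intro: add_pos_pos)
    also have "\<dots> = (\<Sum>j=m..<n. ln (real (x j) / (real (x j) - 1)))"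
      by (intro ln_prod) (auto dest!: x)
    finally show ?thesis .
  qed
  have "(\<Prod>j<n. real (x j)) \<le> 2 ^ 2 ^ n - 2 ^ 2 ^ (n - 1)"
    using \<open>n > 0\<close> tail mono by (intro prod_le_of_tail_bounds) (fastforce dest: x)+
  then show ?thesis by simp
qed

lemma ex_sorted_enumeration:
  fixes f :: "'a \<Rightarrow> 'b::linorder"
  assumes "finite J"
  obtains e where "bij_betw e {..<card J} J" "\<And>j. Suc j < card J \<Longrightarrow> f (e j) \<le> f (e (Suc j))"
proof -
  obtain xs where xs: "set xs = J" "distinct xs"
    using finite_distinct_list[OF assms] by blast
  define ys where "ys = sort_key f xs"
  have len: "length ys = card J" using xs by (simp add: ys_def distinct_card[symmetric])
  have "bij_betw ((!) ys) {..<card J} J"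
    using xs len by (intro bij_betw_nth) (auto simp: ys_def)
  moreover have "sorted (map f ys)" by (simp add: ys_def)
  then have "f (ys ! j) \<le> f (ys ! Suc j)" if "Suc j < card J" for j
    using sorted_nth_mono[of "map f ys" j "Suc j"] that len by simp
  ultimately show ?thesis using that by blast
qed

text \<open>Flattens the family into one sorted sequence over the disjoint union
  \<open>Sigma I A\<close>; the first component of each pair remembers the summand.\<close>

lemma prod_le_of_sum_prod:
  fixes x :: "'i \<Rightarrow> 'a \<Rightarrow> nat"
  assumes "finite I" and "card I \<noteq> 1"
    and fin: "\<And>i. i \<in> I \<Longrightarrow> finite (A i)"
    and x: "\<And>i a. i \<in> I \<Longrightarrow> a \<in> A i \<Longrightarrow> x i a \<ge> 2"
    and eq: "(\<Sum>i\<in>I. \<Prod>a\<in>A i. 1 - 1 / real (x i a)) = 1"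
    and n: "n = (\<Sum>i\<in>I. card (A i))"
  shows "real (\<Prod>i\<in>I. \<Prod>a\<in>A i. x i a) \<le> 2 ^ 2 ^ n - 2 ^ 2 ^ (n - 1)"
proof -
  define J where "J = Sigma I A"
  have fJ: "finite J" using \<open>finite I\<close> fin by (simp add: J_def)
  have cJ: "card J = n" using \<open>finite I\<close> fin by (simp add: J_def n)
  define X where "X = (\<lambda>(i, a). x i a)"
  obtain e where e: "bij_betw e {..<n} J" "\<And>j. Suc j < n \<Longrightarrow> X (e j) \<le> X (e (Suc j))"
    using ex_sorted_enumeration[OF fJ, of X] unfolding cJ by blast
  have eJ: "e j \<in> J" if "j < n" for j using bij_betwE[OF e(1)] that by auto
  \<comment> \<open>For \<open>n = 0\<close> all products are empty and the sum is
    \<open>card I\<close>, which is not \<open>1\<close>.\<close>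
  have "n > 0"
  proof (rule ccontr)
    assume "\<not> n > 0"
    then have "A i = {}" if "i \<in> I" for i using n that fin \<open>finite I\<close> by auto
    then show False using eq \<open>card I \<noteq> 1\<close> by simp
  qed
  have "(\<Prod>j<n. if fst (e j) = i then 1 - 1 / real (X (e j)) else 1) =
      (\<Prod>a\<in>A i. 1 - 1 / real (x i a))" if i: "i \<in> I" for i
  proof -
    have "(\<Prod>j<n. if fst (e j) = i then 1 - 1 / real (X (e j)) else 1) =
        (\<Prod>q\<in>J. if fst q = i then 1 - 1 / real (X q) else 1)"
      by (rule prod.reindex_bij_betw[OF e(1)])
    also have "\<dots> = (\<Prod>q\<in>{i} \<times> A i. 1 - 1 / real (X q))"
      using i fJ by (intro prod.mono_neutral_cong_right) (auto simp: J_def)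
    also have "\<dots> = (\<Prod>a\<in>A i. 1 - 1 / real (x i a))"
      unfolding X_def using prod.cartesian_product[of "\<lambda>i a. 1 - 1 / real (x i a)" "A i" "{i}"]
      by (simp add: case_prod_unfold)
    finally show ?thesis .
  qed
  then have "(\<Sum>i\<in>I. \<Prod>j<n. if fst (e j) = i then 1 - 1 / real (X (e j)) else 1) = 1"
    using eq by simp
  then have "real (\<Prod>j<n. X (e j)) \<le> 2 ^ 2 ^ n - 2 ^ 2 ^ (n - 1)"
    using \<open>finite I\<close> \<open>n > 0\<close> e(2) eJ x
    by (intro prod_le_of_sum_prod_sorted[where I = I and c = "\<lambda>j. fst (e j)"])
      (fastforce simp: J_def X_def)+
  also have "(\<Prod>j<n. X (e j)) = (\<Prod>q\<in>J. X q)"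
    by (rule prod.reindex_bij_betw[OF e(1)])
  also have "\<dots> = (\<Prod>i\<in>I. \<Prod>a\<in>A i. x i a)"
    using \<open>finite I\<close> fin by (simp add: J_def X_def prod.Sigma)
  finally show ?thesis .
qed

section \<open>The arithmetic-geometric mean inequality\<close>

text \<open>Uses \<open>t \<le> exp (t - 1)\<close> at \<open>t = card I * r i\<close>; the
  exponents add up to \<open>0\<close>.\<close>

lemma card_pow_mult_prod_le_one:
  fixes r :: "'i \<Rightarrow> real"
  assumes "finite I" "\<And>i. i \<in> I \<Longrightarrow> r i \<ge> 0" "(\<Sum>i\<in>I. r i) = 1"
  shows "real (card I) ^ card I * (\<Prod>i\<in>I. r i) \<le> 1"
proof -
  have "real (card I) ^ card I * (\<Prod>i\<in>I. r i) = (\<Prod>i\<in>I. card I * r i)"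
    by (simp add: prod.distrib)
  also have "\<dots> \<le> (\<Prod>i\<in>I. exp (card I * r i - 1))"
  proof (intro prod_mono conjI)
    fix i assume "i \<in> I"
    show "card I * r i \<le> exp (card I * r i - 1)"
      using exp_ge_add_one_self[of "card I * r i - 1"] by simp
  qed (use assms in auto)
  also have "\<dots> = exp (\<Sum>i\<in>I. card I * r i - 1)"
    using assms by (simp add: exp_sum)
  also have "\<dots> = 1"
    using assms by (simp add: sum_subtractf sum_distrib_left[symmetric])
  finally show ?thesis .
qed

section \<open>Multiplicativity of the divisor sums\<close>

text \<open>Divisors of a coprime product factor uniquely. The general summand \<open>g\<close> lets
  this serve both \<open>sigma\<close> and, through \<open>unitary_sigma_alt\<close>,
  \<open>unitary_sigma\<close>.\<close>

lemma sum_divisors_mult: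
  fixes g :: "nat \<Rightarrow> 'a::comm_semiring_1"
  assumes "coprime m n" "m > 0" "n > 0"
  shows "(\<Sum>d | d dvd m * n. g d) = (\<Sum>a | a dvd m. \<Sum>b | b dvd n. g (a * b))"
proof -
  have "bij_betw (\<lambda>(a, b). a * b) ({a. a dvd m} \<times> {b. b dvd n}) {d. d dvd m * n}"
    unfolding bij_betw_def
  proof
    show "inj_on (\<lambda>(a, b). a * b) ({a. a dvd m} \<times> {b. b dvd n})"
    proof (rule inj_onI, clarify)
      fix a b a' b' assume dvd: "a dvd m" "b dvd n" "a' dvd m" "b' dvd n" and eq: "a * b = a' * b'"
      have cop: "coprime u v" if "u dvd m" "v dvd n" for u v
        using assms(1) that by (rule coprime_divisors[rotated 2])
      have "a dvd a'" "a' dvd a"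
        using cop[of a b'] cop[of a' b] dvd eq
        by (metis coprime_dvd_mult_left_iff dvd_triv_left)+
      then have "a = a'" by (rule dvd_antisym)
      moreover have "a > 0" using dvd assms by (auto intro: dvd_pos_nat)
      ultimately show "a = a' \<and> b = b'" using eq by simp
    qed
    show "(\<lambda>(a, b). a * b) ` ({a. a dvd m} \<times> {b. b dvd n}) = {d. d dvd m * n}"
      by (auto intro: mult_dvd_mono elim!: dvd_productE simp: image_iff)
  qed
  from sum.reindex_bij_betw[OF this, of g]
  show ?thesis by (simp add: case_prod_unfold sum.cartesian_product)
qed

lemma sigma_mult:
  assumes "coprime m n" "m > 0" "n > 0"
  shows "sigma (m * n) = sigma m * sigma n"
  unfolding sigma_def sum_divisors_mult[OF assms] sum_product ..

lemma unitary_sigma_alt: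
  "n > 0 \<Longrightarrow> unitary_sigma n = (\<Sum>d | d dvd n. if coprime d (n div d) then d else 0)"
  unfolding unitary_sigma_def coprime_iff_gcd_eq_1
  by (subst sum.inter_filter[symmetric]) (auto intro!: sum.cong)

lemma unitary_sigma_mult:
  assumes "coprime m n" "m > 0" "n > 0"
  shows "unitary_sigma (m * n) = unitary_sigma m * unitary_sigma n"
proof -
  \<comment> \<open>The cross conditions between divisors of \<open>m\<close> and divisors of
    \<open>n\<close> hold automatically.\<close>
  have "coprime (a * b) (m * n div (a * b)) \<longleftrightarrow> coprime a (m div a) \<and> coprime b (n div b)"
    if "a dvd m" "b dvd n" for a b
  proof -
    have *: "coprime u v" if "u dvd m" "v dvd n" for u v
      using assms(1) that by (rule coprime_divisors[rotated 2])
    have "m * n div (a * b) = (m div a) * (n div b)"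
      using that by (simp add: div_mult_div_if_dvd)
    moreover have "coprime a (n div b)" "coprime (m div a) b"
      using * that by (auto simp: div_dvd_iff_mult intro!: *)
    ultimately show ?thesis by (auto simp: coprime_commute)
  qed
  then show ?thesis
    using assms
    by (simp add: unitary_sigma_alt sum_divisors_mult[OF assms] sum_product)
      (auto intro!: sum.cong)
qed

lemma multiplicative_eq_prod_prime_powers:
  fixes f :: "nat \<Rightarrow> 'a::comm_monoid_mult"
  assumes "f 1 = 1" and mult: "\<And>m n. coprime m n \<Longrightarrow> m > 0 \<Longrightarrow> n > 0 \<Longrightarrow> f (m * n) = f m * f n"
    and "n > 0"
  shows "f n = (\<Prod>p\<in>prime_factors n. f (p ^ multiplicity p n))"
proof -
  \<comment> \<open>Arbitrary prime sets and exponents are allowed so that the induction on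
    \<open>S\<close> goes through.\<close>
  have "f (\<Prod>p\<in>S. p ^ e p) = (\<Prod>p\<in>S. f (p ^ e p))"
    if "finite S" "\<forall>p\<in>S. prime p" for S and e :: "nat \<Rightarrow> nat"
    using that
  proof (induction S rule: finite_induct)
    case empty
    then show ?case using \<open>f 1 = 1\<close> by simp
  next
    case (insert p S)
    have "coprime (p ^ e p) (\<Prod>q\<in>S. q ^ e q)"
      using insert by (intro prod_coprime_right coprime_power_left_iff[THEN iffD2] disjI1
          coprime_power_right_iff[THEN iffD2]) (auto intro!: primes_coprime)
    then have "f (p ^ e p * (\<Prod>q\<in>S. q ^ e q)) = f (p ^ e p) * f (\<Prod>q\<in>S. q ^ e q)"
      using insert by (intro mult) (auto intro!: prod_pos simp: prime_gt_0_nat)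
    then show ?case using insert by simp
  qed
  from this[of "prime_factors n" "\<lambda>p. multiplicity p n"] show ?thesis
    by (simp add: prime_factorization_nat[OF \<open>n > 0\<close>, symmetric] in_prime_factors_imp_prime)
qed

section \<open>Values at prime powers\<close>

lemma sigma_prime_power:
  assumes "prime p"
  shows "sigma (p ^ a) = (\<Sum>j\<le>a. p ^ j)"
proof -
  have "{d. d dvd p ^ a} = (\<lambda>j. p ^ j) ` {..a}"
    using assms by (auto simp: divides_primepow_nat)
  moreover have "inj_on (\<lambda>j. p ^ j) {..a}"
    using prime_gt_1_nat[OF assms] by (auto intro: inj_onI)
  ultimately show ?thesis unfolding sigma_def by (simp add: sum.reindex)
qed

lemma sigma_prime_power_Suc:
  "prime p \<Longrightarrow> sigma (p ^ Suc a) = Suc (p * sigma (p ^ a))"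
  by (simp only: sigma_prime_power sum.atMost_Suc_shift) (simp add: sum_distrib_left)

lemma sigma_one: "sigma 1 = 1"
  by (simp add: sigma_def)

lemma sigma_prime_power_pos: "prime p \<Longrightarrow> sigma (p ^ a) > 0"
  by (cases a) (use sigma_one in \<open>auto simp only: power_0 sigma_prime_power_Suc\<close>)

lemma sigma_prime_power_ge_two:
  assumes "prime p" "a > 0"
  shows "sigma (p ^ a) \<ge> 2"
proof -
  obtain b where "a = Suc b" using assms(2) gr0_conv_Suc by blast
  moreover have "p * sigma (p ^ b) > 0"
    using assms sigma_prime_power_pos by (simp add: prime_gt_0_nat)
  ultimately show ?thesis
    using sigma_prime_power_Suc[OF assms(1), of b] by simp
qed

text \<open>By \<open>sigma_prime_power_Suc\<close> the factor for \<open>j\<close> equals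
  \<open>p * sigma (p ^ (j - 1)) / sigma (p ^ j)\<close>, so the product telescopes.\<close>

lemma prime_power_div_sigma:
  assumes "prime p"
  shows "real (p ^ a) / real (sigma (p ^ a)) = (\<Prod>j=1..a. 1 - 1 / real (sigma (p ^ j)))"
proof (induction a)
  case 0
  then show ?case using sigma_one by simp
next
  case (Suc a)
  have "sigma (p ^ a) > 0" using assms by (rule sigma_prime_power_pos)
  moreover have "real p * real (sigma (p ^ a)) + 1 > 0" by (intro add_nonneg_pos) auto
  ultimately have "real (p ^ Suc a) / real (sigma (p ^ Suc a)) =
      real (p ^ a) / real (sigma (p ^ a)) * (1 - 1 / real (sigma (p ^ Suc a)))"
    unfolding sigma_prime_power_Suc[OF assms] by (simp add: field_simps)
  also have "\<dots> = (\<Prod>j=1..Suc a. 1 - 1 / real (sigma (p ^ j)))"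
    unfolding Suc.IH by simp
  finally show ?case .
qed

text \<open>The left side is the last factor on the right when \<open>a > 0\<close>, and the other
  factors are at least \<open>1\<close>. This supplies hypothesis \<open>le\<close> of
  \<open>prod_le_harmonious_bound\<close>.\<close>

lemma sigma_prime_power_le_prod:
  assumes "prime p"
  shows "sigma (p ^ a) \<le> (\<Prod>j=1..a. sigma (p ^ j))"
proof (cases a)
  case 0
  then show ?thesis using sigma_one by simp
next
  case (Suc b)
  have "(\<Prod>j=1..b. sigma (p ^ j)) > 0"
    using sigma_prime_power_pos[OF assms] by (intro prod_pos) auto
  then have "1 * sigma (p ^ a) \<le> (\<Prod>j=1..b. sigma (p ^ j)) * sigma (p ^ a)"
    by (intro mult_right_mono) (simp_all only: Suc_le_eq One_nat_def zero_le)
  then show ?thesis unfolding Suc by simp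
qed

lemma unitary_sigma_one: "unitary_sigma 1 = 1"
proof -
  have "{d. d dvd (1::nat) \<and> gcd d (1 div d) = 1} = {1}" by auto
  then show ?thesis by (simp add: unitary_sigma_def)
qed

lemma unitary_sigma_prime_power:
  assumes "prime p" "a > 0"
  shows "unitary_sigma (p ^ a) = p ^ a + 1"
proof -
  have p: "p > 1" using assms(1) by (rule prime_gt_1_nat)
  have "d = 1 \<or> d = p ^ a" if dvd: "d dvd p ^ a" and gcd: "gcd d (p ^ a div d) = 1" for d
  proof -
    obtain i where i: "i \<le> a" "d = p ^ i"
      using dvd divides_primepow_nat[OF assms(1)] by blast
    then have "p ^ a div d = p ^ (a - i)" using p by (simp add: power_diff)
    then have "coprime (p ^ i) (p ^ (a - i))" using gcd i by (simp add: coprime_iff_gcd_eq_1)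
    then have "i = 0 \<or> a - i = 0" using p by (auto simp: coprime_power_left_iff coprime_power_right_iff)
    then show ?thesis using i by auto
  qed
  then have "{d. d dvd p ^ a \<and> gcd d (p ^ a div d) = 1} = {1, p ^ a}"
    using p by auto
  \<comment> \<open>Since \<open>a > 0\<close>, the two elements are distinct.\<close>
  moreover have "\<Sum>{1, p ^ a} = 1 + p ^ a"
    using one_less_power[OF p assms(2)] by (subst sum.insert) auto
  ultimately show ?thesis by (simp add: unitary_sigma_def)
qed

section \<open>Counting prime factors, and the bound for general denominators\<close>

lemma big_omega_eq_sum_multiplicity:
  assumes "n > 0"
  shows "big_omega n = (\<Sum>p\<in>prime_factors n. multiplicity p n)"
  unfolding big_omega_def size_multiset_overloaded_eq
  by (intro sum.cong) (auto simp: count_prime_factorization)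

lemma big_omega_prod:
  assumes "finite I" "\<And>i. i \<in> I \<Longrightarrow> f i > 0"
  shows "big_omega (\<Prod>i\<in>I. f i) = (\<Sum>i\<in>I. big_omega (f i))"
  using assms
proof (induction I rule: finite_induct)
  case empty
  then show ?case by (simp add: big_omega_def)
next
  case (insert i I)
  then have "(\<Prod>i\<in>I. f i) \<noteq> 0" by auto
  then show ?case using insert by (simp add: big_omega_def prime_factorization_mult)
qed

text \<open>The arithmetic-geometric mean inequality for the terms \<open>M i / s i\<close> yields the
  factor \<open>1 / k ^ k\<close> and leaves the product of the \<open>s i\<close> to be estimated.\<close>

lemma prod_le_harmonious_bound:
  fixes M s :: "nat \<Rightarrow> nat" and x :: "nat \<Rightarrow> 'a \<Rightarrow> nat"
  assumes "k \<ge> 2"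
    and eq: "(\<Sum>i=1..k. real (M i) / real (s i)) = 1"
    and s: "\<And>i. i \<in> {1..k} \<Longrightarrow> s i > 0"
    and fin: "\<And>i. i \<in> {1..k} \<Longrightarrow> finite (A i)"
    and x: "\<And>i a. i \<in> {1..k} \<Longrightarrow> a \<in> A i \<Longrightarrow> x i a \<ge> 2"
    and frac: "\<And>i. i \<in> {1..k} \<Longrightarrow>
      real (M i) / real (s i) = (\<Prod>a\<in>A i. 1 - 1 / real (x i a))"
    and le: "\<And>i. i \<in> {1..k} \<Longrightarrow> s i \<le> (\<Prod>a\<in>A i. x i a)"
  shows "real (\<Prod>i=1..k. M i) \<le> harmonious_bound k (\<Sum>i=1..k. card (A i))"
proof -
  let ?L = "\<Sum>i=1..k. card (A i)"
  have k: "real k ^ k > 0" using \<open>k \<ge> 2\<close> by simp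
  have "real (\<Prod>i=1..k. M i) = (\<Prod>i=1..k. real (M i) / real (s i)) * real (\<Prod>i=1..k. s i)"
    unfolding of_nat_prod prod.distrib[symmetric]
  proof (intro prod.cong refl)
    fix i assume "i \<in> {1..k}"
    then show "real (M i) = real (M i) / real (s i) * real (s i)"
      using s[of i] by simp
  qed
  also have "(\<Prod>i=1..k. real (M i) / real (s i)) \<le> 1 / real k ^ k"
    using card_pow_mult_prod_le_one[of "{1..k}" "\<lambda>i. real (M i) / real (s i)"] eq k
    by (simp add: pos_le_divide_eq mult.commute)
  then have "(\<Prod>i=1..k. real (M i) / real (s i)) * real (\<Prod>i=1..k. s i) \<le>
      1 / real k ^ k * real (\<Prod>i=1..k. s i)"
    by (rule mult_right_mono) (rule of_nat_0_le_iff)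
  also have "real (\<Prod>i=1..k. s i) \<le> real (\<Prod>i=1..k. \<Prod>a\<in>A i. x i a)"
    using le by (intro of_nat_mono prod_mono) auto
  also have "\<dots> \<le> 2 ^ 2 ^ ?L - 2 ^ 2 ^ (?L - 1)"
  \<comment> \<open>Here \<open>k \<ge> 2\<close> ensures that the index set does not have exactly
    one element.\<close>
  proof (rule prod_le_of_sum_prod)
    show "(\<Sum>i=1..k. \<Prod>a\<in>A i. 1 - 1 / real (x i a)) = 1"
      using eq frac by simp
  qed (use \<open>k \<ge> 2\<close> fin x in auto)
  finally show ?thesis
    using k by (simp add: harmonious_bound_def power_int_minus divide_inverse mult_left_mono)
qed

section \<open>Harmonious and unitary harmonious tuples\<close>

theorem theorem4:
  fixes k :: nat
  assumes "k \<ge> 2"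
  shows "(\<forall>M. harmonious k M \<longrightarrow>
            real (\<Prod>i=1..k. M i) \<le> harmonious_bound k (big_omega (\<Prod>i=1..k. M i))) \<and>
         (\<forall>M. unitary_harmonious k M \<longrightarrow>
            real (\<Prod>i=1..k. M i) \<le> harmonious_bound k (\<Sum>i=1..k. small_omega (M i)))"
proof (intro conjI allI impI)
  fix M assume "harmonious k M"
  then have pos: "\<And>i. i \<in> {1..k} \<Longrightarrow> M i > 0"
    and eq: "(\<Sum>i=1..k. real (M i) / real (sigma (M i))) = 1"
    by (auto simp: harmonious_def)
  \<comment> \<open>One pair per prime factor counted with multiplicity, so the cardinality is
    \<open>big_omega (M i)\<close>.\<close>
  let ?A = "\<lambda>i. SIGMA p : prime_factors (M i). {1..multiplicity p (M i)}"
  have prod: "n = (\<Prod>p\<in>prime_factors n. p ^ multiplicity p n)"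
    "sigma n = (\<Prod>p\<in>prime_factors n. sigma (p ^ multiplicity p n))" if "n > 0" for n
    using prime_factorization_nat[OF that]
      multiplicative_eq_prod_prime_powers[of sigma, OF sigma_one sigma_mult that] by auto
  have "real (\<Prod>i=1..k. M i) \<le> harmonious_bound k (\<Sum>i=1..k. card (?A i))"
  proof (rule prod_le_harmonious_bound[OF \<open>k \<ge> 2\<close> eq,
        where A = ?A and x = "\<lambda>i (p, j). sigma (p ^ j)"])
    fix i assume "i \<in> {1..k}"
    then have "M i > 0" by (rule pos)
    show "sigma (M i) > 0"
      unfolding prod(2)[OF \<open>M i > 0\<close>]
      by (intro prod_pos ballI sigma_prime_power_pos) (rule in_prime_factors_imp_prime)
    show "finite (?A i)" by simp
    have "real (M i) / real (sigma (M i)) = (\<Prod>p\<in>prime_factors (M i).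
        real (p ^ multiplicity p (M i)) / real (sigma (p ^ multiplicity p (M i))))"
      unfolding prod_dividef
      by (simp only: of_nat_prod[symmetric] prod[OF \<open>M i > 0\<close>, symmetric])
    also have "\<dots> = (\<Prod>p\<in>prime_factors (M i). \<Prod>j=1..multiplicity p (M i). 1 - 1 / real (sigma (p ^ j)))"
      by (intro prod.cong refl prime_power_div_sigma) (rule in_prime_factors_imp_prime)
    also have "\<dots> = (\<Prod>(p, j)\<in>?A i. 1 - 1 / real (sigma (p ^ j)))"
      by (simp add: prod.Sigma)
    finally show "real (M i) / real (sigma (M i)) =
        (\<Prod>a\<in>?A i. 1 - 1 / real (case a of (p, j) \<Rightarrow> sigma (p ^ j)))"
      by (simp add: case_prod_unfold)
    have "sigma (M i) = (\<Prod>p\<in>prime_factors (M i). sigma (p ^ multiplicity p (M i)))"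
      by (rule prod(2)[OF \<open>M i > 0\<close>])
    also have "\<dots> \<le> (\<Prod>p\<in>prime_factors (M i). \<Prod>j=1..multiplicity p (M i). sigma (p ^ j))"
      by (intro prod_mono conjI sigma_prime_power_le_prod) (auto intro: in_prime_factors_imp_prime)
    also have "\<dots> = (\<Prod>(p, j)\<in>?A i. sigma (p ^ j))"
      by (simp add: prod.Sigma)
    finally show "sigma (M i) \<le> (\<Prod>(p, j)\<in>?A i. sigma (p ^ j))" .
  qed (auto intro!: sigma_prime_power_ge_two dest: in_prime_factors_imp_prime)
  also have "(\<Sum>i=1..k. card (?A i)) = (\<Sum>i=1..k. big_omega (M i))"
    using pos by (intro sum.cong) (auto simp: big_omega_eq_sum_multiplicity)
  also have "\<dots> = big_omega (\<Prod>i=1..k. M i)"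
    using pos by (intro big_omega_prod[symmetric]) auto
  finally show "real (\<Prod>i=1..k. M i) \<le> harmonious_bound k (big_omega (\<Prod>i=1..k. M i))" .
next
  fix M assume "unitary_harmonious k M"
  then have pos: "\<And>i. i \<in> {1..k} \<Longrightarrow> M i > 0"
    and eq: "(\<Sum>i=1..k. real (M i) / real (unitary_sigma (M i))) = 1"
    by (auto simp: unitary_harmonious_def)
  have prod: "n = (\<Prod>p\<in>prime_factors n. p ^ multiplicity p n)"
    "unitary_sigma n = (\<Prod>p\<in>prime_factors n. p ^ multiplicity p n + 1)" if "n > 0" for n
  proof -
    show "n = (\<Prod>p\<in>prime_factors n. p ^ multiplicity p n)"
      by (rule prime_factorization_nat[OF that])
    have "unitary_sigma n = (\<Prod>p\<in>prime_factors n. unitary_sigma (p ^ multiplicity p n))"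
      by (rule multiplicative_eq_prod_prime_powers[OF unitary_sigma_one unitary_sigma_mult that])
    also have "\<dots> = (\<Prod>p\<in>prime_factors n. p ^ multiplicity p n + 1)"
      by (intro prod.cong refl unitary_sigma_prime_power)
        (auto simp: prime_factors_multiplicity)
    finally show "unitary_sigma n = (\<Prod>p\<in>prime_factors n. p ^ multiplicity p n + 1)" .
  qed
  have "real (\<Prod>i=1..k. M i) \<le> harmonious_bound k (\<Sum>i=1..k. card (prime_factors (M i)))"
  \<comment> \<open>In the unitary case each distinct prime contributes the single factor
    \<open>q / (q + 1)\<close>, where \<open>q\<close> is its full power in \<open>M i\<close>;
    hence \<open>small_omega\<close> replaces \<open>big_omega\<close>.\<close>
  proof (rule prod_le_harmonious_bound[OF \<open>k \<ge> 2\<close> eq,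
        where x = "\<lambda>i p. p ^ multiplicity p (M i) + 1"])
    fix i assume "i \<in> {1..k}"
    then have "M i > 0" by (rule pos)
    show "unitary_sigma (M i) > 0"
      unfolding prod(2)[OF \<open>M i > 0\<close>] by (intro prod_pos) auto
    have "real (M i) / real (unitary_sigma (M i)) = (\<Prod>p\<in>prime_factors (M i).
        real (p ^ multiplicity p (M i)) / real (p ^ multiplicity p (M i) + 1))"
      unfolding prod_dividef
      by (simp only: of_nat_prod[symmetric] prod[OF \<open>M i > 0\<close>, symmetric])
    also have "\<dots> = (\<Prod>p\<in>prime_factors (M i). 1 - 1 / real (p ^ multiplicity p (M i) + 1))"
    proof (intro prod.cong refl)
      fix p
      have "q / (q + 1) = 1 - 1 / (q + 1)" if "q \<ge> 0" for q :: real
        using that by (simp add: field_simps)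
      from this[of "real (p ^ multiplicity p (M i))"]
      show "real (p ^ multiplicity p (M i)) / real (p ^ multiplicity p (M i) + 1) =
          1 - 1 / real (p ^ multiplicity p (M i) + 1)" by (simp add: add.commute)
    qed
    finally show "real (M i) / real (unitary_sigma (M i)) =
        (\<Prod>p\<in>prime_factors (M i). 1 - 1 / real (p ^ multiplicity p (M i) + 1))" .
    show "unitary_sigma (M i) \<le> (\<Prod>p\<in>prime_factors (M i). p ^ multiplicity p (M i) + 1)"
      by (rule eq_refl[OF prod(2)[OF \<open>M i > 0\<close>]])
  next
    fix i p assume "p \<in> prime_factors (M i)"
    then have "p > 0" by (auto dest: in_prime_factors_imp_prime prime_gt_0_nat)
    then show "p ^ multiplicity p (M i) + 1 \<ge> 2" by (simp add: Suc_le_eq)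
  qed simp
  then show "real (\<Prod>i=1..k. M i) \<le> harmonious_bound k (\<Sum>i=1..k. small_omega (M i))"
    by (simp add: small_omega_def)
qed

end
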